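(* For every integer $n\ge 1$, the statistics $(F,\mathrm{maj},\mathrm{stat},\mathrm{des},\mathrm{ides})$ over $S_n(213)$ are equidistributed with the statistics $(F,\mathrm{stat},\mathrm{maj},\mathrm{des},\mathrm{ides})$ over $S_n(231)$; that is, for all integers $a,b,c,d,e$, $$\#\{\pi\in S_n(213): F(\pi)=a,\ \mathrm{maj}(\pi)=b,\ \mathrm{stat}(\pi)=c,\ \mathrm{des}(\pi)=d,\ \mathrm{ides}(\pi)=e\}$$ $$=\#\{\sigma\in S_n(231): F(\sigma)=a,\ \mathrm{stat}(\sigma)=b,\ \mathrm{maj}(\sigma)=c,\ \mathrm{des}(\sigma)=d,\ \mathrm{ides}(\sigma)=e\}.$$
   Context: $S_n$ is the set of permutations $\pi=\pi_1\pi_2\cdots\pi_n$ (one-line notation) of $[n]=\{1,\dots,n\}$. A permutation $\pi$ contains a pattern $\sigma\in S_k$ if some (not necessarily contiguous) subsequence $\pi_{i_1}\cdots\pi_{i_k}$, $i_1<\cdots<i_k$, is order isomorphic to $\sigma$; otherwise $\pi$ is $\sigma$-avoiding. $S_n(\sigma)$ is the set of $\sigma$-avoiding permutations in $S_n$. Statistics on $\pi\in S_n$: $F(\pi)=\pi_1$; the descent set is $D(\pi)=\{i\in[n-1]:\pi_i>\pi_{i+1}\}$; $\mathrm{des}(\pi)=|D(\pi)|$; $\mathrm{ides}(\pi)=\mathrm{des}(\pi^{-1})$, where $\pi^{-1}$ is the inverse permutation; $\mathrm{maj}(\pi)=\sum_{i\in D(\pi)} i$; and $\mathrm{stat}=(13\text{-}2)+(21\text{-}3)+(32\text{-}1)+(21)$,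 where each term counts occurrences of a generalized pattern (letters not separated by a dash must be adjacent in the permutation). Explicitly, $(21)\pi=\mathrm{des}(\pi)$, and $(13\text{-}2)\pi$, $(21\text{-}3)\pi$, $(32\text{-}1)\pi$ are the numbers of pairs $(i,j)$ with $1\le i$, $i+1<j\le n$ such that, respectively, $\pi_i<\pi_j<\pi_{i+1}$; $\pi_{i+1}<\pi_i<\pi_j$; $\pi_j<\pi_{i+1}<\pi_i$. *)

theory Defs
  imports Main "HOL-Combinatorics.Permutations"
begin

text \<open>
  A permutation of \<open>[n]\<close> is a function \<open>p\<close> with \<open>p permutes {1..n}\<close>; its one-line notation is
  \<open>p 1, p 2, \<dots>, p n\<close>. Since \<open>p\<close> does not determine \<open>n\<close> (it is the identity outside \<open>{1..n}\<close>),
  \<open>n\<close> is an explicit parameter of the statistics.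
\<close>

definition one_line :: "nat list \<Rightarrow> nat \<Rightarrow> nat" where
  "one_line xs i = (if i \<in> {1..length xs} then xs ! (i - 1) else i)"

definition contains_pattern :: "nat \<Rightarrow> (nat \<Rightarrow> nat) \<Rightarrow> nat \<Rightarrow> (nat \<Rightarrow> nat) \<Rightarrow> bool" where
  "contains_pattern k \<sigma> n p \<longleftrightarrow>
     (\<exists>f. f ` {1..k} \<subseteq> {1..n} \<and> strict_mono_on {1..k} f \<and>
          (\<forall>a\<in>{1..k}. \<forall>b\<in>{1..k}. p (f a) < p (f b) \<longleftrightarrow> \<sigma> a < \<sigma> b))"

text \<open>The pattern is given by its one-line notation.\<close>

definition avoiders :: "nat \<Rightarrow> nat list \<Rightarrow> (nat \<Rightarrow> nat) set" where
  "avoiders n xs =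
     {p. p permutes {1..n} \<and> \<not> contains_pattern (length xs) (one_line xs) n p}"

definition first_letter :: "(nat \<Rightarrow> nat) \<Rightarrow> nat" where
  "first_letter p = p 1"

definition descents :: "nat \<Rightarrow> (nat \<Rightarrow> nat) \<Rightarrow> nat set" where
  "descents n p = {i \<in> {1..n - 1}. p i > p (i + 1)}"

definition des :: "nat \<Rightarrow> (nat \<Rightarrow> nat) \<Rightarrow> nat" where
  "des n p = card (descents n p)"

definition ides :: "nat \<Rightarrow> (nat \<Rightarrow> nat) \<Rightarrow> nat" where
  "ides n p = des n (inv p)"

definition maj :: "nat \<Rightarrow> (nat \<Rightarrow> nat) \<Rightarrow> nat" where
  "maj n p = \<Sum>(descents n p)"

text \<open>
  Occurrences of the generalized patterns 13-2, 21-3 and 32-1: the first two letters are adjacent,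
  at positions \<open>i\<close> and \<open>i + 1\<close>, and the third one is at a later position \<open>j\<close>.
\<close>

definition occ_13_2 :: "nat \<Rightarrow> (nat \<Rightarrow> nat) \<Rightarrow> nat" where
  "occ_13_2 n p = card {(i, j). 1 \<le> i \<and> i + 1 < j \<and> j \<le> n \<and> p i < p j \<and> p j < p (i + 1)}"

definition occ_21_3 :: "nat \<Rightarrow> (nat \<Rightarrow> nat) \<Rightarrow> nat" where
  "occ_21_3 n p = card {(i, j). 1 \<le> i \<and> i + 1 < j \<and> j \<le> n \<and> p (i + 1) < p i \<and> p i < p j}"

definition occ_32_1 :: "nat \<Rightarrow> (nat \<Rightarrow> nat) \<Rightarrow> nat" where
  "occ_32_1 n p = card {(i, j). 1 \<le> i \<and> i + 1 < j \<and> j \<le> n \<and> p j < p (i + 1) \<and> p (i + 1) < p i}"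

text \<open>The last summand is the number of occurrences of the generalized pattern 21.\<close>

definition stat :: "nat \<Rightarrow> (nat \<Rightarrow> nat) \<Rightarrow> nat" where
  "stat n p = occ_13_2 n p + occ_21_3 n p + occ_32_1 n p + des n p"

end

theory Submission
  imports Defs
begin

text \<open>
  Write a permutation in \<open>S\<^sub>n(213)\<close> as \<open>\<sigma> 1 \<tau>\<close>, so that \<open>\<sigma> > \<tau>\<close>, and one in \<open>S\<^sub>n(231)\<close> as
  \<open>\<sigma> n \<tau>\<close>, so that \<open>\<sigma> < \<tau>\<close>. The recursive bijection \<open>\<psi>(\<sigma> 1 \<tau>) = \<psi>(\<tau>) n \<psi>(\<sigma>)\<close> (each factor
  standardized or shifted as needed) preserves \<open>des\<close> and takes \<open>(maj + des, stat + F - 1)\<close> to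
  \<open>(stat + F - 1, maj + des)\<close>. It changes \<open>F\<close>, so it is applied only below the first letter: a
  permutation with first letter \<open>a\<close> is \<open>a B S\<close> if it avoids 213 and \<open>a S B\<close> if it avoids 231, where
  \<open>S < a < B\<close>, and \<open>a B S \<mapsto> a \<psi>(S) \<psi>(B)\<close> is the required bijection: \<open>maj(a B S)\<close> and
  \<open>stat(a S B)\<close> are the same function of \<open>des\<close> and of \<open>maj + des\<close>, respectively \<open>stat + F - 1\<close>,
  of the two parts, and similarly for \<open>stat(a B S)\<close> and \<open>maj(a S B)\<close>. The same decomposition
  at the first letter shows that \<open>ides = des\<close> on both classes.
\<close>

section \<open>Statistics of words\<close>

primrec ldes :: "nat list \<Rightarrow> nat" where
  "ldes [] = 0"
| "ldes (x # xs) = ldes xs + (if xs \<noteq> [] \<and> hd xs < x then 1 else 0)"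

text \<open>Prepending a letter moves every descent one place to the right and may create one at
  position 1; together this adds the descent number of the longer word.\<close>

primrec lmaj :: "nat list \<Rightarrow> nat" where
  "lmaj [] = 0"
| "lmaj (x # xs) = lmaj xs + ldes (x # xs)"

text \<open>For a one-letter word \<open>hd xs\<close> is unspecified, but then \<open>tl xs\<close>
  is empty and nothing is counted.\<close>

primrec locc :: "(nat \<Rightarrow> nat \<Rightarrow> nat \<Rightarrow> bool) \<Rightarrow> nat list \<Rightarrow> nat" where
  "locc R [] = 0"
| "locc R (x # xs) = locc R xs + length (filter (R x (hd xs)) (tl xs))"

definition lstat :: "nat list \<Rightarrow> nat" where
  "lstat xs = locc (\<lambda>x y z. x < z \<and> z < y) xs + locc (\<lambda>x y z. y < x \<and> x < z) xs
     + locc (\<lambda>x y z. z < y \<and> y < x) xs + ldes xs"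

text \<open>A descent of the inverse at \<open>y\<close> means that the value \<open>Suc y\<close>
  stands to the left of \<open>y\<close>.\<close>

primrec lides :: "nat list \<Rightarrow> nat" where
  "lides [] = 0"
| "lides (x # xs) = lides xs + (if \<exists>y\<in>set xs. x = Suc y then 1 else 0)"

text \<open>On a permutation of \<open>[n]\<close> this is \<open>F - 1\<close>, but it is invariant under shifts of the letters.\<close>

definition below_head :: "nat list \<Rightarrow> nat" where
  "below_head xs = length (filter (\<lambda>z. z < hd xs) xs)"

text \<open>\<open>sorted_wrt\<close> compares all ordered pairs of later letters, not only
  neighbours, as a pattern without adjacency requires.\<close>

primrec avoids :: "(nat \<Rightarrow> nat \<Rightarrow> nat \<Rightarrow> bool) \<Rightarrow> nat list \<Rightarrow> bool" where
  "avoids R [] \<longleftrightarrow> True"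
| "avoids R (x # xs) \<longleftrightarrow> sorted_wrt (\<lambda>y z. \<not> R x y z) xs \<and> avoids R xs"

section \<open>Statistics of a concatenation of two blocks, one lying entirely below the
  other\<close>

lemma ldes_append:
  "ldes (xs @ ys) = ldes xs + ldes ys + (if xs \<noteq> [] \<and> ys \<noteq> [] \<and> hd ys < last xs then 1 else 0)"
  by (induction xs) (auto simp: hd_append)

lemma ldes_append_less:
  assumes "\<forall>x\<in>set xs. \<forall>y\<in>set ys. x < y"
  shows "ldes (xs @ ys) = ldes xs + ldes ys"
  using bspec[OF bspec[OF assms, of "last xs"], of "hd ys"] by (auto simp: ldes_append)

lemma ldes_append_greater:
  assumes "\<forall>x\<in>set xs. \<forall>y\<in>set ys. y < x"
  shows "ldes (xs @ ys) = ldes xs + ldes ys + (if xs \<noteq> [] \<and> ys \<noteq> [] then 1 else 0)"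
  using bspec[OF bspec[OF assms, of "last xs"], of "hd ys"] by (auto simp: ldes_append)

text \<open>Every descent of \<open>ys\<close> moves right by \<open>length xs\<close>, and the
  junction contributes none.\<close>

lemma lmaj_append_less:
  assumes "\<forall>x\<in>set xs. \<forall>y\<in>set ys. x < y"
  shows "lmaj (xs @ ys) = lmaj xs + lmaj ys + length xs * ldes ys"
  using assms
proof (induction xs)
  case (Cons x xs)
  have "ldes ((x # xs) @ ys) = ldes (x # xs) + ldes ys"
    using Cons.prems by (rule ldes_append_less)
  with Cons show ?case by (simp del: ldes.simps)
qed simp

text \<open>Here the junction of two nonempty words is itself a descent, at position
  \<open>length xs\<close>.\<close>

lemma lmaj_append_greater:
  assumes "\<forall>x\<in>set xs. \<forall>y\<in>set ys. y < x"
  shows "lmaj (xs @ ys) = lmaj xs + lmaj ys + length xs * ldes ys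
    + (if ys \<noteq> [] then length xs else 0)"
  using assms
proof (induction xs)
  case (Cons x xs)
  have "ldes ((x # xs) @ ys) = ldes (x # xs) + ldes ys + (if x # xs \<noteq> [] \<and> ys \<noteq> [] then 1 else 0)"
    using Cons.prems by (rule ldes_append_greater)
  with Cons show ?case by (simp del: ldes.simps)
qed simp

lemma below_head_Nil [simp]: "below_head [] = 0"
  by (simp add: below_head_def)

lemma lstat_Nil [simp]: "lstat [] = 0"
  and lstat_single [simp]: "lstat [x] = 0"
  by (simp_all add: lstat_def)

lemma lstat_Cons2:
  "lstat (x # y # xs) = lstat (y # xs) + (if y < x then 1 else 0)
    + length (filter (\<lambda>z. x < z \<and> z < y) xs) + length (filter (\<lambda>z. y < x \<and> x < z) xs)
    + length (filter (\<lambda>z. z < y \<and> y < x) xs)"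
  by (simp add: lstat_def)

lemma length_filter_eqI:
  "(\<And>x. x \<in> set xs \<Longrightarrow> P x \<longleftrightarrow> Q x) \<Longrightarrow> length (filter P xs) = length (filter Q xs)"
  by (metis filter_cong)

text \<open>Each descent of \<open>xs\<close> forms a 21-3 with every letter of \<open>ys\<close>.
  The junction is an ascent and forms a 13-2 with each letter of \<open>ys\<close> below
  \<open>hd ys\<close>.\<close>

lemma lstat_append_less:
  assumes "\<forall>x\<in>set xs. \<forall>y\<in>set ys. x < y"
  shows "lstat (xs @ ys) = lstat xs + lstat ys + length ys * ldes xs
    + (if xs \<noteq> [] then below_head ys else 0)"
  using assms
proof (induction xs)
  case (Cons x xs)
  show ?case
  proof (cases xs)
    case Nil
    show ?thesis
    proof (cases ys)
      case ys: (Cons y zs)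
      then have "x < y" "\<forall>z\<in>set zs. x < z" using Cons.prems ys by auto
      then show ?thesis using Nil ys
        by (auto simp: lstat_Cons2 below_head_def filter_empty_conv intro!: length_filter_eqI)
    qed (use Nil in simp)
  next
    case (Cons y zs)
    have "lstat (xs @ ys) = lstat xs + lstat ys + length ys * ldes xs + below_head ys"
      using Cons.IH Cons.prems Cons by simp
    moreover have "filter (\<lambda>z. x < z \<and> z < y) ys = []" "filter (\<lambda>z. z < y \<and> y < x) ys = []"
      "filter (\<lambda>z. y < x \<and> x < z) ys = (if y < x then ys else [])"
      using Cons.prems Cons by (force simp: filter_empty_conv filter_id_conv)+
    ultimately show ?thesis using Cons by (simp add: lstat_Cons2)
  qed
qed simp

text \<open>Each descent of \<open>xs\<close> forms a 32-1 with every letter of \<open>ys\<close>.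
  The junction is a descent: it counts once as 21 and forms a 32-1 with each letter of
  \<open>ys\<close> below \<open>hd ys\<close>.\<close>

lemma lstat_append_greater:
  assumes "\<forall>x\<in>set xs. \<forall>y\<in>set ys. y < x"
  shows "lstat (xs @ ys) = lstat xs + lstat ys + length ys * ldes xs
    + (if xs \<noteq> [] \<and> ys \<noteq> [] then below_head ys + 1 else 0)"
  using assms
proof (induction xs)
  case (Cons x xs)
  show ?case
  proof (cases xs)
    case Nil
    show ?thesis
    proof (cases ys)
      case ys: (Cons y zs)
      then have "y < x" "\<forall>z\<in>set zs. z < x" using Cons.prems ys by auto
      then show ?thesis using Nil ys
        by (auto simp: lstat_Cons2 below_head_def filter_empty_conv intro!: length_filter_eqI)
    qed (use Nil in simp)
  next
    case (Cons y zs)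
    have "lstat (xs @ ys) = lstat xs + lstat ys + length ys * ldes xs 
        + (if ys \<noteq> [] then below_head ys + 1 else 0)"
      using Cons.IH Cons.prems Cons by simp
    moreover have "filter (\<lambda>z. x < z \<and> z < y) ys = []" "filter (\<lambda>z. y < x \<and> x < z) ys = []"
      "filter (\<lambda>z. z < y \<and> y < x) ys = (if y < x then ys else [])"
      using Cons.prems Cons by (force simp: filter_empty_conv filter_id_conv)+
    ultimately show ?thesis using Cons by (simp add: lstat_Cons2)
  qed
qed simp

lemma below_head_append_less:
  assumes "\<forall>x\<in>set xs. \<forall>y\<in>set ys. x < y"
  shows "below_head (xs @ ys) = (if xs = [] then below_head ys else below_head xs)"
  using bspec[OF assms, of "hd xs"] by (force simp: below_head_def filter_empty_conv)

lemma below_head_append_greater: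
  assumes "\<forall>x\<in>set xs. \<forall>y\<in>set ys. y < x"
  shows "below_head (xs @ ys) = (if xs = [] then below_head ys else below_head xs + length ys)"
proof (cases "xs = []")
  case False
  then have "filter (\<lambda>z. z < hd xs) ys = ys"
    using bspec[OF assms, of "hd xs"] by (simp add: filter_id_conv)
  with False show ?thesis by (simp add: below_head_def)
qed simp

lemma lides_append:
  assumes "\<And>x y. x \<in> set xs \<Longrightarrow> y \<in> set ys \<Longrightarrow> x \<noteq> Suc y"
  shows "lides (xs @ ys) = lides xs + lides ys"
  using assms by (induction xs) auto

section \<open>Invariance of the statistics under shifts of the letters\<close>

lemma ldes_shift [simp]: "ldes (map (\<lambda>x. x + c) xs) = ldes xs"
  by (induction xs) (auto simp: hd_map)

lemma lmaj_shift [simp]: "lmaj (map (\<lambda>x. x + c) xs) = lmaj xs"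
proof (induction xs)
  case (Cons x xs)
  then show ?case using ldes_shift[of c "x # xs"] by (simp del: ldes.simps)
qed simp

lemma lides_shift [simp]: "lides (map (\<lambda>x. x + c) xs) = lides xs"
  by (induction xs) auto

lemma below_head_shift [simp]: "below_head (map (\<lambda>x. x + c) xs) = below_head xs"
  by (cases xs) (auto simp: below_head_def filter_map o_def)

lemma lstat_shift [simp]: "lstat (map (\<lambda>x. x + c) xs) = lstat xs"
proof (induction xs)
  case (Cons x xs)
  then show ?case by (cases xs) (auto simp: lstat_Cons2 filter_map o_def)
qed simp

section \<open>Avoidance under relabelling, restriction and concatenation\<close>

lemma avoids_map:
  assumes "\<And>x y z. x \<in> set xs \<Longrightarrow> y \<in> set xs \<Longrightarrow> z \<in> set xs \<Longrightarrow> R (f x) (f y) (f z) \<longleftrightarrow> R x y z"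
  shows "avoids R (map f xs) \<longleftrightarrow> avoids R xs"
  using assms
proof (induction xs)
  case (Cons x xs)
  have "sorted_wrt (\<lambda>y z. \<not> R (f x) (f y) (f z)) xs \<longleftrightarrow> sorted_wrt (\<lambda>y z. \<not> R x y z) xs"
    by (intro iffI; erule sorted_wrt_mono_rel[rotated]) (use Cons.prems in auto)
  with Cons show ?case by (simp add: sorted_wrt_map)
qed simp

lemma avoids_filter: "avoids R xs \<Longrightarrow> avoids R (filter P xs)"
  by (induction xs) (auto intro: sorted_wrt_filter)

lemma sorted_wrtI:
  "(\<And>x y. x \<in> set xs \<Longrightarrow> y \<in> set xs \<Longrightarrow> P x y) \<Longrightarrow> sorted_wrt P xs"
  by (induction xs) auto

text \<open>A triple that straddles the junction begins in \<open>xs\<close> and ends in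
  \<open>ys\<close>, while its middle letter may be in either word.\<close>

lemma avoids_append:
  assumes "avoids R xs" "avoids R ys"
    and "\<And>x y z. x \<in> set xs \<Longrightarrow> z \<in> set ys \<Longrightarrow> y \<in> set xs \<union> set ys \<Longrightarrow> \<not> R x y z"
  shows "avoids R (xs @ ys)"
  using assms by (induction xs) (auto simp: sorted_wrt_append intro!: sorted_wrtI)

text \<open>Applied to the letters after the first one, with \<open>P\<close> saying "larger" for
  213 and "smaller" for 231: avoidance by triples starting at the first letter is then exactly the
  hypothesis.\<close>

lemma sorted_wrt_partition:
  assumes "sorted_wrt (\<lambda>y z. \<not> (\<not> P y \<and> P z)) xs"
  shows "xs = filter P xs @ filter (\<lambda>x. \<not> P x) xs"
  using assms
proof (induction xs)
  case (Cons x xs)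
  show ?case
  proof (cases "P x")
    case False
    then have "filter P xs = []" using Cons.prems by (auto simp: filter_empty_conv)
    then show ?thesis using False Cons by (simp add: filter_id_conv filter_empty_conv)
  qed (use Cons in simp)
qed simp

section \<open>Decompositions of pattern-avoiding words\<close>

abbreviation R213 :: "nat \<Rightarrow> nat \<Rightarrow> nat \<Rightarrow> bool" where
  "R213 x y z \<equiv> y < x \<and> x < z"

abbreviation R231 :: "nat \<Rightarrow> nat \<Rightarrow> nat \<Rightarrow> bool" where
  "R231 x y z \<equiv> z < x \<and> x < y"

definition words :: "(nat \<Rightarrow> nat \<Rightarrow> nat \<Rightarrow> bool) \<Rightarrow> nat \<Rightarrow> nat list set" where
  "words R n = {xs. distinct xs \<and> set xs = {1..n} \<and> avoids R xs}"

lemma words_length: "xs \<in> words R n \<Longrightarrow> length xs = n"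
  unfolding words_def by (auto dest: distinct_card)

lemma words_set: "xs \<in> words R n \<Longrightarrow> set xs = {1..n}"
  by (simp add: words_def)

lemma words_0 [simp]: "words R 0 = {[]}"
  by (auto simp: words_def)

lemma finite_words: "finite (words R n)"
proof (rule finite_subset)
  show "words R n \<subseteq> {xs. set xs \<subseteq> {1..n} \<and> length xs = n}"
    using words_length by (auto simp: words_def)
qed (rule finite_lists_length_eq, simp)

section \<open>Binary trees as a common index set for both classes\<close>

datatype tree = Leaf | Node tree tree

primrec build :: "(nat list \<Rightarrow> nat list \<Rightarrow> nat list) \<Rightarrow> tree \<Rightarrow> nat list" where
  "build f Leaf = []"
| "build f (Node l r) = f (build f l) (build f r)"

text \<open>
  Surjectivity is deduced from that of a second composition \<open>g\<close> by counting.
\<close>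

lemma bij_betw_build:
  assumes into: "\<And>k m a b. a \<in> words R k \<Longrightarrow> b \<in> words R m \<Longrightarrow> f a b \<in> words R (Suc (k + m))"
    and inj: "\<And>k m a b k' m' a' b'. a \<in> words R k \<Longrightarrow> b \<in> words R m \<Longrightarrow> a' \<in> words R k' \<Longrightarrow>
      b' \<in> words R m' \<Longrightarrow> f a b = f a' b' \<Longrightarrow> a = a' \<and> b = b'"
    and surj: "\<And>n xs. xs \<in> words R (Suc n) \<Longrightarrow>
      \<exists>k m. \<exists>a\<in>words R k. \<exists>b\<in>words R m. n = k + m \<and> xs = g a b"
  shows "bij_betw (build f) {t. size t = n} (words R n)"
proof -
  have into': "build f t \<in> words R (size t)" for t
    by (induction t) (auto dest: into)
  have inj': "inj (build f)"
  proof (rule injI)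
    fix t u show "build f t = build f u \<Longrightarrow> t = u"
    proof (induction t arbitrary: u)
      case Leaf
      then show ?case using words_length[OF into'[of u]] by (cases u) auto
    next
      case (Node l r)
      note n = Node
      show ?case
      proof (cases u)
        case Leaf
        then show ?thesis using Node.prems words_length[OF into'[of "Node l r"]] by simp
      next
        case (Node l' r')
        then show ?thesis using n inj[OF into' into' into' into', of l r l' r'] by auto
      qed
    qed
  qed
  \<comment> \<open>The trees found here build \<open>xs\<close> through \<open>g\<close>; through
    \<open>f\<close> they may build other words. Only their number will matter.\<close>
  have surj': "xs \<in> words R n \<Longrightarrow> \<exists>t. size t = n \<and> xs = build g t" for xs n
  proof (induction n arbitrary: xs rule: less_induct)
    case (less n)
    show ?case
    proof (cases n)
      case 0
      then show ?thesis using less.prems by (intro exI[of _ Leaf]) auto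
    next
      case (Suc n')
      then obtain k m a b where *: "a \<in> words R k" "b \<in> words R m" "n' = k + m" "xs = g a b"
        using surj less.prems by blast
      then obtain l r where "size l = k" "a = build g l" "size r = m" "b = build g r"
        using less.IH[of k a] less.IH[of m b] Suc by auto
      then show ?thesis using * Suc by (intro exI[of _ "Node l r"]) auto
    qed
  qed
  have sub: "build f ` {t. size t = n} \<subseteq> words R n" using into' by auto
  \<comment> \<open>\<open>build f\<close> embeds the trees of size \<open>n\<close> into a finite
    set of words.\<close>
  then have fin: "finite {t :: tree. size t = n}"
    by (rule inj_on_finite[OF inj_on_subset[OF inj' subset_UNIV] _ finite_words])
  \<comment> \<open>Through \<open>g\<close> there are at least as many trees as words, and through
    \<open>f\<close> the trees embed into the words, so the image under \<open>build f\<close> is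
    everything.\<close>
  have "card (words R n) \<le> card {t :: tree. size t = n}"
    using surj' by (intro surj_card_le[OF fin, of _ "build g"]) auto
  also have "\<dots> = card (build f ` {t. size t = n})"
    by (rule card_image[symmetric], rule inj_on_subset[OF inj' subset_UNIV])
  finally have "build f ` {t. size t = n} = words R n"
    using card_mono[OF finite_words sub] by (intro card_subset_eq[OF finite_words sub]) simp
  then show ?thesis using inj_on_subset[OF inj' subset_UNIV] by (simp add: bij_betw_def)
qed

text \<open>Splitting at the first letter: \<open>s\<close> is the word of the smaller letters and
  \<open>b\<close> that of the larger ones, standardized. A smaller letter ahead of a larger one
  would complete a 213.\<close>

definition first213 :: "nat list \<Rightarrow> nat list \<Rightarrow> nat list" where
  "first213 s b = (Suc (length s) # map (\<lambda>x. x + Suc (length s)) b) @ s"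

definition first231 :: "nat list \<Rightarrow> nat list \<Rightarrow> nat list" where
  "first231 s b = (Suc (length s) # s) @ map (\<lambda>x. x + Suc (length s)) b"

text \<open>Splitting at the letter 1: a letter before 1 that is smaller than some letter after it
  would complete a 213, so the left factor is the one shifted upwards past \<open>b\<close>.\<close>

definition min213 :: "nat list \<Rightarrow> nat list \<Rightarrow> nat list" where
  "min213 a b = map (\<lambda>x. x + Suc (length b)) a @ 1 # map (\<lambda>x. x + 1) b"

text \<open>
  The factors are swapped relative to \<open>min213\<close>, so that \<open>\<psi>\<close> becomes building the two words
  from the same tree.
\<close>

definition max231 :: "nat list \<Rightarrow> nat list \<Rightarrow> nat list" where
  "max231 a b = b @ Suc (length a + length b) # map (\<lambda>x. x + length b) a"

lemma shift_image: "(\<lambda>x. x + c) ` {1..n} = {Suc c..c + n}" for c n :: nat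
  by (metis add.commute image_add_atLeastAtMost' plus_1_eq_Suc)

section \<open>The compositions preserve avoidance\<close>

lemma words_shift:
  assumes "b \<in> words R m" and "\<And>x y z. R (x + c) (y + c) (z + c) \<longleftrightarrow> R x y z"
  shows "set (map (\<lambda>x. x + c) b) = {Suc c..c + m}" "distinct (map (\<lambda>x. x + c) b)"
    "avoids R (map (\<lambda>x. x + c) b)"
proof -
  show "set (map (\<lambda>x. x + c) b) = {Suc c..c + m}"
    by (simp only: set_map words_set[OF assms(1)] shift_image)
  show "distinct (map (\<lambda>x. x + c) b)"
    using assms(1) by (simp add: words_def distinct_map inj_on_def)
  show "avoids R (map (\<lambda>x. x + c) b)"
    using assms by (subst avoids_map) (auto simp: words_def)
qed

text \<open>A 213 across the junction needs its last letter above its first, but the left block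
  exceeds \<open>s\<close>; a 213 starting at \<open>Suc k\<close> inside the left block needs a
  smaller letter there. The other three compositions are treated likewise.\<close>

lemma first213_words:
  assumes "s \<in> words R213 k" "b \<in> words R213 m"
  shows "first213 s b \<in> words R213 (Suc (k + m))"
proof -
  define b' where "b' = map (\<lambda>x. x + Suc k) b"
  have b': "set b' = {Suc (Suc k)..Suc k + m}" "distinct b'" "avoids R213 b'"
    unfolding b'_def by (rule words_shift[OF assms(2)], simp)+
  have s: "set s = {1..k}" "distinct s" "avoids R213 s"
    using assms(1) by (auto simp: words_def)
  have eq: "first213 s b = (Suc k # b') @ s"
    by (simp add: first213_def b'_def words_length[OF assms(1)])
  have "avoids R213 (first213 s b)"
    unfolding eq using s b' by (intro avoids_append) (auto intro!: sorted_wrtI)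
  moreover have "distinct (first213 s b)" "set (first213 s b) = {1..Suc (k + m)}"
    unfolding eq using s b' by auto
  ultimately show ?thesis by (simp add: words_def)
qed

lemma first231_words:
  assumes "s \<in> words R231 k" "b \<in> words R231 m"
  shows "first231 s b \<in> words R231 (Suc (k + m))"
proof -
  define b' where "b' = map (\<lambda>x. x + Suc k) b"
  have b': "set b' = {Suc (Suc k)..Suc k + m}" "distinct b'" "avoids R231 b'"
    unfolding b'_def by (rule words_shift[OF assms(2)], simp)+
  have s: "set s = {1..k}" "distinct s" "avoids R231 s"
    using assms(1) by (auto simp: words_def)
  have eq: "first231 s b = (Suc k # s) @ b'"
    by (simp add: first231_def b'_def words_length[OF assms(1)])
  have "avoids R231 (first231 s b)"
    unfolding eq using s b' by (intro avoids_append) (auto intro!: sorted_wrtI)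
  moreover have "distinct (first231 s b)" "set (first231 s b) = {1..Suc (k + m)}"
    unfolding eq using s b' by auto
  ultimately show ?thesis by (simp add: words_def)
qed

lemma min213_words:
  assumes "a \<in> words R213 k" "b \<in> words R213 m"
  shows "min213 a b \<in> words R213 (Suc (k + m))"
proof -
  define a' where "a' = map (\<lambda>x. x + Suc m) a"
  have a': "set a' = {Suc (Suc m)..Suc m + k}" "distinct a'" "avoids R213 a'"
    unfolding a'_def by (rule words_shift[OF assms(1)], simp)+
  define b' where "b' = map (\<lambda>x. x + 1) b"
  have b': "set b' = {Suc 1..1 + m}" "distinct b'" "avoids R213 b'"
    unfolding b'_def by (rule words_shift[OF assms(2)], simp)+
  have eq: "min213 a b = a' @ 1 # b'"
    by (simp add: min213_def a'_def b'_def words_length[OF assms(1)] words_length[OF assms(2)])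
  have "avoids R213 (min213 a b)"
    unfolding eq using a' b' by (intro avoids_append) (auto intro!: sorted_wrtI)
  moreover have "distinct (min213 a b)" "set (min213 a b) = {1..Suc (k + m)}"
    unfolding eq using a' b' by auto
  ultimately show ?thesis by (simp add: words_def)
qed

lemma max231_words:
  assumes "a \<in> words R231 k" "b \<in> words R231 m"
  shows "max231 a b \<in> words R231 (Suc (k + m))"
proof -
  define a' where "a' = map (\<lambda>x. x + m) a"
  have a': "set a' = {Suc (m)..m + k}" "distinct a'" "avoids R231 a'"
    unfolding a'_def by (rule words_shift[OF assms(1)], simp)+
  have b': "set b = {1..m}" "distinct b" "avoids R231 b"
    using assms(2) by (auto simp: words_def)
  have eq: "max231 a b = b @ Suc (k + m) # a'"
    by (simp add: max231_def a'_def words_length[OF assms(1)] words_length[OF assms(2)])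
  have "avoids R231 (max231 a b)"
    unfolding eq using a' b' by (intro avoids_append) (auto intro!: sorted_wrtI)
  moreover have "distinct (max231 a b)" "set (max231 a b) = {1..Suc (k + m)}"
    unfolding eq using a' b' by auto
  ultimately show ?thesis by (simp add: words_def)
qed

section \<open>Injectivity of the compositions\<close>

lemma inj_shift: "map (\<lambda>x. x + c) xs = map (\<lambda>x. x + c) ys \<longleftrightarrow> xs = ys" for c :: nat
  by (simp add: inj_def)

text \<open>The first letter reveals \<open>length s\<close>, hence the shift of \<open>b\<close>
  and the length of the suffix to cut off.\<close>

lemma first213_inject:
  assumes "first213 s b = first213 s' b'"
  shows "s = s' \<and> b = b'"
proof -
  have l: "length s = length s'" using assms by (simp add: first213_def)
  then have "map (\<lambda>x. x + Suc (length s)) b = map (\<lambda>x. x + Suc (length s)) b' \<and> s = s'"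
    using assms by (simp add: first213_def)
  then show ?thesis by (metis inj_shift)
qed

lemma first231_inject:
  assumes "first231 s b = first231 s' b'"
  shows "s = s' \<and> b = b'"
proof -
  have l: "length s = length s'" using assms by (simp add: first231_def)
  then have "map (\<lambda>x. x + Suc (length s)) b = map (\<lambda>x. x + Suc (length s)) b' \<and> s = s'"
    using assms by (simp add: first231_def)
  then show ?thesis by (metis inj_shift)
qed

text \<open>The unique letter 1 marks the cut. It yields \<open>b\<close>, and
  \<open>length b\<close> is what fixes the shift of \<open>a\<close>.\<close>

lemma min213_inject:
  assumes "a \<in> words R k" "b \<in> words R m" "a' \<in> words R k'" "b' \<in> words R m'"
    and eq: "min213 a b = min213 a' b'"
  shows "a = a' \<and> b = b'"
proof -
  have "1 \<notin> set (map (\<lambda>x. x + Suc (length b)) a)" "1 \<notin> set (map (\<lambda>x. x + 1) b)"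
    "1 \<notin> set (map (\<lambda>x. x + Suc (length b')) a')" "1 \<notin> set (map (\<lambda>x. x + 1) b')"
    using assms(1-4) by (auto simp: words_def)
  then have *: "map (\<lambda>x. x + Suc (length b)) a = map (\<lambda>x. x + Suc (length b')) a'"
    "map (\<lambda>x. x + 1) b = map (\<lambda>x. x + 1) b'"
    using eq unfolding min213_def by (auto simp: append_Cons_eq_iff)
  then have "b = b'" by (simp only: inj_shift)
  with * show ?thesis by (simp only: inj_shift)
qed

text \<open>Equal total lengths make the two maximal letters equal, and the unique maximal letter
  marks the cut.\<close>

lemma max231_inject:
  assumes "a \<in> words R k" "b \<in> words R m" "a' \<in> words R k'" "b' \<in> words R m'"
    and eq: "max231 a b = max231 a' b'"
  shows "a = a' \<and> b = b'"
proof -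
  have "length (max231 a b) = length (max231 a' b')" using eq by simp
  then have l: "length a + length b = length a' + length b'" by (simp add: max231_def)
  have "Suc (length a + length b) \<notin> set b" "Suc (length a' + length b') \<notin> set b'"
    "Suc (length a + length b) \<notin> set (map (\<lambda>x. x + length b) a)"
    "Suc (length a' + length b') \<notin> set (map (\<lambda>x. x + length b') a')"
    using assms(1-4)[THEN words_length] assms(1-4)[THEN words_set] by auto
  then have *: "b = b'" "map (\<lambda>x. x + length b) a = map (\<lambda>x. x + length b') a'"
    using eq l unfolding max231_def by (auto simp: append_Cons_eq_iff)
  then show ?thesis by (simp only: inj_shift)
qed

section \<open>Every avoiding word splits at its first letter\<close>

lemma words_standardize:
  assumes "distinct xs" "set xs = {Suc c..c + n}" "avoids R xs"
    and "\<And>x y z c. R (x + c) (y + c) (z + c) \<longleftrightarrow> R x y z"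
  shows "\<exists>ys\<in>words R n. xs = map (\<lambda>x. x + c) ys"
proof
  let ?ys = "map (\<lambda>x. x - c) xs"
  show eq: "xs = map (\<lambda>x. x + c) ?ys"
    using assms(2) by (auto simp: o_def intro!: map_idI[symmetric])
  have "avoids R ?ys"
    using assms(3,4) by (subst (asm) eq, subst (asm) avoids_map) auto
  moreover have "set ?ys = {1..n}"
  proof -
    have "set ?ys = (\<lambda>x. x - c) ` (\<lambda>x. x + c) ` {1..n}"
      unfolding set_map assms(2) shift_image ..
    also have "\<dots> = {1..n}" unfolding image_image by simp
    finally show ?thesis .
  qed
  moreover have "distinct ?ys"
    using assms(1,2) by (auto simp: distinct_map inj_on_def)
  ultimately show "?ys \<in> words R n" by (simp add: words_def)
qed

text \<open>The part common to both patterns: it extracts the smaller and the larger letters as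
  avoiding words. How the two are interleaved depends on the pattern and is settled in the two
  lemmas that follow.\<close>

lemma words_first:
  assumes "x # ys \<in> words R (Suc n)" and R: "\<And>x y z c. R (x + c) (y + c) (z + c) \<longleftrightarrow> R x y z"
  obtains k m s b where "n = k + m" "x = Suc k" "s \<in> words R k" "b \<in> words R m"
    "filter (\<lambda>y. y < x) ys = s" "filter (\<lambda>y. x < y) ys = map (\<lambda>y. y + Suc k) b"
proof -
  define k where "k = x - 1"
  define m where "m = n - k"
  have set: "insert x (set ys) = {1..Suc n}" and d: "x \<notin> set ys" "distinct ys"
    and av: "avoids R ys"
    using assms(1) by (auto simp: words_def)
  have x: "1 \<le> x" "x \<le> Suc n" using set by auto
  have n: "n = k + m" and x': "x = Suc k" using x by (auto simp: k_def m_def)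
  have sy: "set ys = {1..Suc n} - {x}" using set d by auto
  have "filter (\<lambda>y. y < x) ys \<in> words R k"
    using d av x by (auto simp: words_def sy x' n intro: avoids_filter)
  moreover have "\<exists>b\<in>words R m. filter (\<lambda>y. x < y) ys = map (\<lambda>y. y + Suc k) b"
    using d av x R by (intro words_standardize avoids_filter) (auto simp: sy x' n)
  ultimately show ?thesis using that n x' by blast
qed

lemma first213_surj:
  assumes "xs \<in> words R213 (Suc n)"
  shows "\<exists>k m. \<exists>s\<in>words R213 k. \<exists>b\<in>words R213 m. n = k + m \<and> xs = first213 s b"
proof -
  obtain x ys where xs: "xs = x # ys" using words_length[OF assms] by (cases xs) auto
  obtain k m s b where *: "n = k + m" "x = Suc k" "s \<in> words R213 k" "b \<in> words R213 m"
    "filter (\<lambda>y. y < x) ys = s" "filter (\<lambda>y. x < y) ys = map (\<lambda>y. y + Suc k) b"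
    by (rule words_first[OF assms[unfolded xs]]) auto
  have x: "x \<notin> set ys" and sorted: "sorted_wrt (\<lambda>y z. \<not> R213 x y z) ys"
    using assms xs by (auto simp: words_def)
  then have ne: "y < x \<or> x < y" if "y \<in> set ys" for y
    using that by (metis linorder_neqE_nat)
  \<comment> \<open>No later letter equals \<open>x\<close>, so \<open>\<not> x < y\<close> means
    \<open>y < x\<close>: avoidance forbids a smaller letter ahead of a larger one.\<close>
  from sorted have "sorted_wrt (\<lambda>y z. \<not> (\<not> x < y \<and> x < z)) ys"
    using ne by (elim sorted_wrt_mono_rel[rotated]) (meson linorder_neqE_nat)
  then have "ys = filter (\<lambda>y. x < y) ys @ filter (\<lambda>y. \<not> x < y) ys"
    by (rule sorted_wrt_partition)
  also have "filter (\<lambda>y. \<not> x < y) ys = filter (\<lambda>y. y < x) ys"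
    using ne by (intro filter_cong refl) (meson less_asym)
  finally have "xs = first213 s b"
    using * words_length[OF *(3)] by (simp add: first213_def xs)
  then show ?thesis using * by blast
qed

lemma first231_surj:
  assumes "xs \<in> words R231 (Suc n)"
  shows "\<exists>k m. \<exists>s\<in>words R231 k. \<exists>b\<in>words R231 m. n = k + m \<and> xs = first231 s b"
proof -
  obtain x ys where xs: "xs = x # ys" using words_length[OF assms] by (cases xs) auto
  obtain k m s b where *: "n = k + m" "x = Suc k" "s \<in> words R231 k" "b \<in> words R231 m"
    "filter (\<lambda>y. y < x) ys = s" "filter (\<lambda>y. x < y) ys = map (\<lambda>y. y + Suc k) b"
    by (rule words_first[OF assms[unfolded xs]]) auto
  have x: "x \<notin> set ys" and sorted: "sorted_wrt (\<lambda>y z. \<not> R231 x y z) ys"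
    using assms xs by (auto simp: words_def)
  then have ne: "y < x \<or> x < y" if "y \<in> set ys" for y
    using that by (metis linorder_neqE_nat)
  \<comment> \<open>For 231 the roles are exchanged: no larger letter may precede a smaller
    one.\<close>
  from sorted have "sorted_wrt (\<lambda>y z. \<not> (\<not> y < x \<and> z < x)) ys"
    using ne by (elim sorted_wrt_mono_rel[rotated]) (meson linorder_neqE_nat)
  then have "ys = filter (\<lambda>y. y < x) ys @ filter (\<lambda>y. \<not> y < x) ys"
    by (rule sorted_wrt_partition)
  also have "filter (\<lambda>y. \<not> y < x) ys = filter (\<lambda>y. x < y) ys"
    using ne by (intro filter_cong refl) (meson less_asym)
  finally have "xs = first231 s b"
    using * words_length[OF *(3)] by (simp add: first231_def xs)
  then show ?thesis using * by blast
qed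

section \<open>Coding of both classes by trees\<close>

abbreviation word213 :: "tree \<Rightarrow> nat list" where
  "word213 \<equiv> build min213"

abbreviation word231 :: "tree \<Rightarrow> nat list" where
  "word231 \<equiv> build max231"

text \<open>A decomposition is shown to exist only at the first letter; the counting argument
  carries it over to the splitting at the letter 1, and below to the splitting at the
  maximum.\<close>

lemma bij_betw_word213: "bij_betw word213 {t. size t = n} (words R213 n)"
  by (rule bij_betw_build[OF min213_words min213_inject first213_surj])

lemma bij_betw_word231: "bij_betw word231 {t. size t = n} (words R231 n)"
  by (rule bij_betw_build[OF max231_words max231_inject first231_surj])

lemma word213_words: "word213 t \<in> words R213 (size t)"
  using bij_betw_word213[of "size t"] by (auto simp: bij_betw_def)

lemma word231_words: "word231 t \<in> words R231 (size t)"
  using bij_betw_word231[of "size t"] by (auto simp: bij_betw_def)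

text \<open>For the top level of the bijection: \<open>f\<close> splits off the first letter and
  \<open>h\<close> codes the two remaining parts by trees, whose sizes then determine that
  letter.\<close>

lemma words_bij_betw_pairs:
  assumes into: "\<And>k m a b. a \<in> words R k \<Longrightarrow> b \<in> words R m \<Longrightarrow> f a b \<in> words R (Suc (k + m))"
    and inj: "\<And>a b a' b'. f a b = f a' b' \<Longrightarrow> a = a' \<and> b = b'"
    and surj: "\<And>n xs. xs \<in> words R (Suc n) \<Longrightarrow>
      \<exists>k m. \<exists>a\<in>words R k. \<exists>b\<in>words R m. n = k + m \<and> xs = f a b"
    and h: "\<And>n. bij_betw h {t. size t = n} (words R n)"
  shows "bij_betw (\<lambda>(u, v). f (h u) (h v)) {(u, v). size u + size v = n} (words R (Suc n))"
proof -
  have h_words: "h t \<in> words R (size t)" for t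
    using h[of "size t"] by (auto simp: bij_betw_def)
  have h_inj: "t = u" if "h t = h u" for t u
  proof -
    have "size t = size u"
      using that words_length[OF h_words, of t] words_length[OF h_words, of u] by simp
    then show ?thesis
      using that inj_onD[OF bij_betw_imp_inj_on[OF h[of "size t"]], of t u] by simp
  qed
  have h_surj: "a \<in> words R k \<Longrightarrow> \<exists>t. size t = k \<and> a = h t" for a k
    using h[of k] by (force simp: bij_betw_def)
  show ?thesis
    unfolding bij_betw_def
  proof (intro conjI equalityI subsetI)
    show "inj_on (\<lambda>(u, v). f (h u) (h v)) {(u, v). size u + size v = n}"
      by (auto simp: inj_on_def dest!: inj h_inj)
  next
    fix xs assume "xs \<in> (\<lambda>(u, v). f (h u) (h v)) ` {(u, v). size u + size v = n}"
    then show "xs \<in> words R (Suc n)" using into[OF h_words h_words] by auto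
  next
    fix xs assume "xs \<in> words R (Suc n)"
    then obtain k m a b where *: "a \<in> words R k" "b \<in> words R m" "n = k + m" "xs = f a b"
      using surj by blast
    then obtain u v where "size u = k" "a = h u" "size v = m" "b = h v"
      using h_surj by meson
    then show "xs \<in> (\<lambda>(u, v). f (h u) (h v)) ` {(u, v). size u + size v = n}"
      using * by (intro image_eqI[of _ _ "(u, v)"]) auto
  qed
qed

section \<open>Statistics of the decompositions\<close>

lemma ldes_Cons_less: "\<forall>y\<in>set ys. x < y \<Longrightarrow> ldes (x # ys) = ldes ys"
  using ldes_append_less[of "[x]" ys] by simp

lemma ldes_Cons_greater: "\<forall>y\<in>set ys. y < x \<Longrightarrow> ldes (x # ys) = ldes ys + (if ys \<noteq> [] then 1 else 0)"
  using ldes_append_greater[of "[x]" ys] by simp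

lemma lstat_Cons_less: "\<forall>y\<in>set ys. x < y \<Longrightarrow> lstat (x # ys) = lstat ys + below_head ys"
  using lstat_append_less[of "[x]" ys] by simp

lemma lstat_Cons_greater:
  "\<forall>y\<in>set ys. y < x \<Longrightarrow> lstat (x # ys) = lstat ys + (if ys \<noteq> [] then below_head ys + 1 else 0)"
  using lstat_append_greater[of "[x]" ys] by simp

lemma below_head_Cons_less: "\<forall>y\<in>set ys. x < y \<Longrightarrow> below_head (x # ys) = 0"
  using below_head_append_less[of "[x]" ys] by (simp add: below_head_def)

lemma below_head_Cons_greater: "\<forall>y\<in>set ys. y < x \<Longrightarrow> below_head (x # ys) = length ys"
  using below_head_append_greater[of "[x]" ys] by (simp add: below_head_def)

text \<open>The word is a descending junction of the shifted \<open>a\<close> with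
  \<open>1 # b'\<close>, where 1 lies below all of \<open>b'\<close>. The conditionals record that 1
  ends a descent only if something precedes it.\<close>

lemma min213_stats:
  assumes a: "a \<in> words R k" and b: "b \<in> words R m"
  shows "ldes (min213 a b) = ldes a + ldes b + (if k > 0 then 1 else 0)"
    and "lmaj (min213 a b) = lmaj a + lmaj b + Suc k * ldes b + k"
    and "lstat (min213 a b) = lstat a + lstat b + Suc m * ldes a + below_head b + (if k > 0 then 1 else 0)"
    and "below_head (min213 a b) = (if k > 0 then below_head a + Suc m else 0)"
proof -
  define a' b' where "a' = map (\<lambda>x. x + Suc (length b)) a" and "b' = map (\<lambda>x. x + 1) b"
  have less: "\<forall>y\<in>set b'. 1 < y" using words_set[OF b] by (auto simp: b'_def)
  have greater: "\<forall>x\<in>set a'. \<forall>y\<in>set (1 # b'). y < x"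
    using words_set[OF a] words_set[OF b] words_length[OF b] by (auto simp: a'_def b'_def)
  have *: "min213 a b = a' @ 1 # b'" by (simp add: min213_def a'_def b'_def)
  have inv: "ldes a' = ldes a" "ldes b' = ldes b" "lmaj a' = lmaj a" "lmaj b' = lmaj b"
    "lstat a' = lstat a" "lstat b' = lstat b" "below_head a' = below_head a"
    "below_head b' = below_head b" "length a' = k" "length b' = m" "a' = [] \<longleftrightarrow> k = 0"
    using words_length[OF a] words_length[OF b] unfolding a'_def b'_def
    by (simp_all only: ldes_shift lmaj_shift lstat_shift below_head_shift length_map) auto
  note app = ldes_append_greater[OF greater] lmaj_append_greater[OF greater]
    lstat_append_greater[OF greater] below_head_append_greater[OF greater]
  note Cons = ldes_Cons_less[OF less] lstat_Cons_less[OF less] below_head_Cons_less[OF less]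
  show "ldes (min213 a b) = ldes a + ldes b + (if k > 0 then 1 else 0)"
    "lmaj (min213 a b) = lmaj a + lmaj b + Suc k * ldes b + k"
    "lstat (min213 a b) = lstat a + lstat b + Suc m * ldes a + below_head b + (if k > 0 then 1 else 0)"
    "below_head (min213 a b) = (if k > 0 then below_head a + Suc m else 0)"
    by (simp_all only: * app) (simp_all add: Cons[unfolded One_nat_def] inv del: ldes.simps)
qed

text \<open>The maximum \<open>z\<close> starts a descent only if \<open>a\<close> is nonempty. All
  \<open>k\<close> letters of \<open>a\<close> lie below \<open>z\<close>, which gives the terms
  \<open>k\<close> in \<open>lstat\<close> and \<open>below_head\<close>.\<close>

lemma max231_stats:
  assumes a: "a \<in> words R k" and b: "b \<in> words R m"
  shows "ldes (max231 a b) = ldes a + ldes b + (if k > 0 then 1 else 0)"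
    and "lmaj (max231 a b) = lmaj a + lmaj b + Suc m * ldes a + (if k > 0 then Suc m else 0)"
    and "lstat (max231 a b) = lstat a + lstat b + Suc k * ldes b
      + (if k > 0 then below_head a + 1 else 0) + (if m > 0 then k else 0)"
    and "below_head (max231 a b) = (if m > 0 then below_head b else k)"
proof -
  define a' where "a' = map (\<lambda>x. x + length b) a"
  define z where "z = Suc (length a + length b)"
  have greater: "\<forall>y\<in>set a'. y < z"
    using words_set[OF a] words_length[OF a] by (auto simp: a'_def z_def)
  have less: "\<forall>x\<in>set b. \<forall>y\<in>set (z # a'). x < y"
    using words_set[OF a] words_set[OF b] words_length[OF b] by (auto simp: a'_def z_def)
  have *: "max231 a b = b @ z # a'" by (simp add: max231_def a'_def z_def)
  have inv: "ldes a' = ldes a" "lmaj a' = lmaj a" "lstat a' = lstat a" "below_head a' = below_head a"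
    "length a' = k" "length b = m" "a' = [] \<longleftrightarrow> k = 0" "b = [] \<longleftrightarrow> m = 0"
    using words_length[OF a] words_length[OF b] unfolding a'_def
    by (simp_all only: ldes_shift lmaj_shift lstat_shift below_head_shift length_map) auto
  note app = ldes_append_less[OF less] lmaj_append_less[OF less]
    lstat_append_less[OF less] below_head_append_less[OF less]
  note Cons = ldes_Cons_greater[OF greater] lstat_Cons_greater[OF greater]
    below_head_Cons_greater[OF greater]
  show "ldes (max231 a b) = ldes a + ldes b + (if k > 0 then 1 else 0)"
    "lmaj (max231 a b) = lmaj a + lmaj b + Suc m * ldes a + (if k > 0 then Suc m else 0)"
    "lstat (max231 a b) = lstat a + lstat b + Suc k * ldes b
      + (if k > 0 then below_head a + 1 else 0) + (if m > 0 then k else 0)"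
    "below_head (max231 a b) = (if m > 0 then below_head b else k)"
    by (simp_all only: * app) (simp_all add: Cons inv del: ldes.simps)
qed

lemma first213_stats:
  assumes s: "s \<in> words R k" and b: "b \<in> words R m"
  shows "ldes (first213 s b) = ldes s + ldes b + (if k > 0 then 1 else 0)"
    and "lmaj (first213 s b) = lmaj s + lmaj b + ldes b + Suc m * ldes s + (if k > 0 then Suc m else 0)"
    and "lstat (first213 s b) = lstat s + lstat b + below_head b + k * ldes b
      + (if k > 0 then below_head s + 1 else 0)"
    and "hd (first213 s b) = Suc k"
    and "lides (first213 s b) = lides s + lides b + (if k > 0 then 1 else 0)"
proof -
  define b' where "b' = map (\<lambda>x. x + Suc (length s)) b"
  define z where "z = Suc (length s)"
  have less: "\<forall>y\<in>set b'. z < y"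
    using words_set[OF b] by (auto simp: b'_def z_def)
  have greater: "\<forall>x\<in>set (z # b'). \<forall>y\<in>set s. y < x"
    using words_set[OF s] words_length[OF s] by (auto simp: b'_def z_def)
  have *: "first213 s b = (z # b') @ s" by (simp add: first213_def b'_def z_def)
  have inv: "ldes b' = ldes b" "lmaj b' = lmaj b" "lstat b' = lstat b" "below_head b' = below_head b"
    "lides b' = lides b" "length b' = m" "length s = k" "b' = [] \<longleftrightarrow> m = 0" "s = [] \<longleftrightarrow> k = 0"
    using words_length[OF s] words_length[OF b] unfolding b'_def
    by (simp_all only: ldes_shift lmaj_shift lstat_shift below_head_shift lides_shift length_map) auto
  note app = ldes_append_greater[OF greater] lmaj_append_greater[OF greater]
    lstat_append_greater[OF greater]
  note Cons = ldes_Cons_less[OF less] lstat_Cons_less[OF less]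
  show "ldes (first213 s b) = ldes s + ldes b + (if k > 0 then 1 else 0)"
    "lmaj (first213 s b) = lmaj s + lmaj b + ldes b + Suc m * ldes s + (if k > 0 then Suc m else 0)"
    "lstat (first213 s b) = lstat s + lstat b + below_head b + k * ldes b
      + (if k > 0 then below_head s + 1 else 0)"
    by (simp_all only: * app) (simp_all add: Cons inv del: ldes.simps)
  show "hd (first213 s b) = Suc k" by (simp add: first213_def inv)
  \<comment> \<open>The letters of \<open>b'\<close> are at least \<open>k + 2\<close> and those of
    \<open>s\<close> at most \<open>k\<close>, so no consecutive values straddle the two blocks. The
    one new pair is \<open>z = k + 1\<close> ahead of \<open>k\<close>, present iff \<open>s\<close>
    is nonempty.\<close>
  have "lides (b' @ s) = lides b' + lides s"
    using words_set[OF s] words_set[OF b] inv(7) by (intro lides_append) (auto simp: b'_def)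
  moreover have "(\<exists>y\<in>set (b' @ s). z = Suc y) \<longleftrightarrow> k > 0"
    using less words_set[OF s] inv(7) by (auto simp: z_def)
  ultimately show "lides (first213 s b) = lides s + lides b + (if k > 0 then 1 else 0)"
    by (simp add: * inv)
qed

lemma first231_stats:
  assumes s: "s \<in> words R k" and b: "b \<in> words R m"
  shows "ldes (first231 s b) = ldes s + ldes b + (if k > 0 then 1 else 0)"
    and "lmaj (first231 s b) = lmaj s + ldes s + lmaj b + Suc k * ldes b + (if k > 0 then 1 else 0)"
    and "lstat (first231 s b) = lstat s + lstat b + below_head b + m * ldes s
      + (if k > 0 then below_head s + Suc m else 0)"
    and "hd (first231 s b) = Suc k"
    and "lides (first231 s b) = lides s + lides b + (if k > 0 then 1 else 0)"
proof -
  define b' where "b' = map (\<lambda>x. x + Suc (length s)) b"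
  define z where "z = Suc (length s)"
  have greater: "\<forall>y\<in>set s. y < z"
    using words_set[OF s] words_length[OF s] by (auto simp: z_def)
  have less: "\<forall>x\<in>set (z # s). \<forall>y\<in>set b'. x < y"
    using words_set[OF s] words_length[OF s] words_set[OF b] by (auto simp: b'_def z_def)
  have *: "first231 s b = (z # s) @ b'" by (simp add: first231_def b'_def z_def)
  have inv: "ldes b' = ldes b" "lmaj b' = lmaj b" "lstat b' = lstat b" "below_head b' = below_head b"
    "lides b' = lides b" "length b' = m" "length s = k" "b' = [] \<longleftrightarrow> m = 0" "s = [] \<longleftrightarrow> k = 0"
    using words_length[OF s] words_length[OF b] unfolding b'_def
    by (simp_all only: ldes_shift lmaj_shift lstat_shift below_head_shift lides_shift length_map) auto
  note app = ldes_append_less[OF less] lmaj_append_less[OF less]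
    lstat_append_less[OF less]
  note Cons = ldes_Cons_greater[OF greater] lstat_Cons_greater[OF greater]
  show "ldes (first231 s b) = ldes s + ldes b + (if k > 0 then 1 else 0)"
    "lmaj (first231 s b) = lmaj s + ldes s + lmaj b + Suc k * ldes b + (if k > 0 then 1 else 0)"
    "lstat (first231 s b) = lstat s + lstat b + below_head b + m * ldes s
      + (if k > 0 then below_head s + Suc m else 0)"
    by (simp_all only: * app) (simp_all add: Cons inv del: ldes.simps)
  show "hd (first231 s b) = Suc k" by (simp add: first231_def inv)
  have "lides (s @ b') = lides s + lides b'"
    using words_set[OF s] words_set[OF b] inv(7) by (intro lides_append) (auto simp: b'_def)
  moreover have "(\<exists>y\<in>set (s @ b'). z = Suc y) \<longleftrightarrow> k > 0"
  proof -
    have "\<forall>y\<in>set b'. z < y" using less by simp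
    then show ?thesis using words_set[OF s] inv(7) by (auto simp: z_def Suc_le_eq)
  qed
  ultimately show "lides (first231 s b) = lides s + lides b + (if k > 0 then 1 else 0)"
    by (simp add: * inv)
qed

text \<open>With the corrections \<open>ldes\<close> and \<open>below_head\<close> the recurrences
  agree. For subtrees of sizes \<open>k\<close> and \<open>m\<close>, the second line adds to the
  sums of the parts \<open>Suc k * ldes b + k\<close>, plus 1 if \<open>k > 0\<close>; the third
  adds \<open>Suc m * ldes a\<close>, plus \<open>m + 2\<close> if \<open>k > 0\<close>.\<close>

lemma word213_word231_stats:
  "ldes (word213 t) = ldes (word231 t) \<and>
   lmaj (word213 t) + ldes (word213 t) = lstat (word231 t) + below_head (word231 t) \<and>
   lstat (word213 t) + below_head (word213 t) = lmaj (word231 t) + ldes (word231 t)"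
proof (induction t)
  case (Node l r)
  note A = min213_stats[OF word213_words[of l] word213_words[of r]]
  note B = max231_stats[OF word231_words[of l] word231_words[of r]]
  \<comment> \<open>For an empty subtree \<open>below_head\<close> vanishes, which reconciles the
    conditional terms of the two recurrences.\<close>
  have zero: "size l = 0 \<Longrightarrow> l = Leaf" "size r = 0 \<Longrightarrow> r = Leaf"
    by (cases l; simp; fail) (cases r; simp; fail)
  have des: "ldes (word213 l) = ldes (word231 l)" "ldes (word213 r) = ldes (word231 r)"
    using Node.IH by auto
  have "ldes (min213 (word213 l) (word213 r)) = ldes (max231 (word231 l) (word231 r))"
    by (simp only: A B des)
  moreover have "lmaj (min213 (word213 l) (word213 r)) + ldes (min213 (word213 l) (word213 r)) =
      lstat (max231 (word231 l) (word231 r)) + below_head (max231 (word231 l) (word231 r))"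
    unfolding A B des using Node.IH zero
    by (cases "size l = 0"; cases "size r = 0"; simp only: des; simp; linarith)
  moreover have "lstat (min213 (word213 l) (word213 r)) + below_head (min213 (word213 l) (word213 r)) =
      lmaj (max231 (word231 l) (word231 r)) + ldes (max231 (word231 l) (word231 r))"
    unfolding A B des using Node.IH zero
    by (cases "size l = 0"; cases "size r = 0"; simp only: des; simp; linarith)
  ultimately show ?case by simp
qed simp

text \<open>Under the splitting at the first letter both statistics obey one recurrence: the sum
  over the parts, plus 1 if there are smaller letters.\<close>

lemma lides_eq_ldes_213:
  "xs \<in> words R213 n \<Longrightarrow> lides xs = ldes xs"
proof (induction n arbitrary: xs rule: less_induct)
  case (less n)
  show ?case
  proof (cases n)
    case (Suc n')
    then obtain k m s b where *: "s \<in> words R213 k" "b \<in> words R213 m" "n' = k + m" "xs = first213 s b"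
      using first213_surj less.prems by blast
    then have "lides s = ldes s" "lides b = ldes b" using less.IH[of k s] less.IH[of m b] Suc by auto
    then show ?thesis using first213_stats[OF *(1,2)] *(4) by simp
  qed (use less in simp)
qed

lemma lides_eq_ldes_231:
  "xs \<in> words R231 n \<Longrightarrow> lides xs = ldes xs"
proof (induction n arbitrary: xs rule: less_induct)
  case (less n)
  show ?case
  proof (cases n)
    case (Suc n')
    then obtain k m s b where *: "s \<in> words R231 k" "b \<in> words R231 m" "n' = k + m" "xs = first231 s b"
      using first231_surj less.prems by blast
    then have "lides s = ldes s" "lides b = ldes b" using less.IH[of k s] less.IH[of m b] Suc by auto
    then show ?thesis using first231_stats[OF *(1,2)] *(4) by simp
  qed (use less in simp)
qed

section \<open>Permutations as words\<close>

abbreviation word_of :: "nat \<Rightarrow> (nat \<Rightarrow> nat) \<Rightarrow> nat list" where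
  "word_of n p \<equiv> map p [1..<Suc n]"

text \<open>The left end \<open>m\<close> is kept variable so that a downward induction can prepend
  \<open>p m\<close>; the instance \<open>m = 1\<close> is the one used for permutations.\<close>

lemma ldes_map_upt:
  "m \<le> Suc n \<Longrightarrow> ldes (map p [m..<Suc n]) = card {i. m \<le> i \<and> i < n \<and> p (Suc i) < p i}"
proof (induction m rule: inc_induct)
  case (step m)
  let ?A = "\<lambda>m. {i. m \<le> i \<and> i < n \<and> p (Suc i) < p i}"
  have "?A m = (if m < n \<and> p (Suc m) < p m then insert m (?A (Suc m)) else ?A (Suc m))"
    by (auto simp: le_less Suc_le_eq)
  moreover have "ldes (map p [m..<Suc n]) = ldes (map p [Suc m..<Suc n]) + (if m < n \<and> p (Suc m) < p m then 1 else 0)"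
    using step.hyps by (cases "m < n") (simp_all add: upt_conv_Cons del: upt_Suc)
  ultimately show ?case using step.IH by simp
qed simp

text \<open>In the word starting at index \<open>m\<close>, the letter \<open>p i\<close> has
  position \<open>Suc i - m\<close>.\<close>

lemma lmaj_map_upt:
  "m \<le> Suc n \<Longrightarrow> lmaj (map p [m..<Suc n]) = (\<Sum>i | m \<le> i \<and> i < n \<and> p (Suc i) < p i. Suc i - m)"
proof (induction m rule: inc_induct)
  case (step m)
  let ?A = "\<lambda>m. {i. m \<le> i \<and> i < n \<and> p (Suc i) < p i}"
  have "lmaj (map p [m..<Suc n]) = lmaj (map p [Suc m..<Suc n]) + ldes (map p [m..<Suc n])"
    using step.hyps by (simp add: upt_conv_Cons del: upt_Suc)
  also have "\<dots> = (\<Sum>i\<in>?A (Suc m). Suc i - Suc m) + (\<Sum>i\<in>?A m. 1)"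
    using step.hyps by (simp only: step.IH) (simp add: ldes_map_upt del: upt_Suc)
  \<comment> \<open>The additional index \<open>i = m\<close> contributes 0.\<close>
  also have "(\<Sum>i\<in>?A (Suc m). Suc i - Suc m) = (\<Sum>i\<in>?A m. i - m)"
    by (rule sum.mono_neutral_cong_left) (auto simp: not_less_eq_eq)
  also have "\<dots> + (\<Sum>i\<in>?A m. 1) = (\<Sum>i\<in>?A m. Suc i - m)"
    by (subst sum.distrib[symmetric], rule sum.cong) auto
  finally show ?case .
qed simp

lemma locc_map_upt:
  "m \<le> Suc n \<Longrightarrow> locc R (map p [m..<Suc n]) =
     card {(i, j). m \<le> i \<and> i + 1 < j \<and> j \<le> n \<and> R (p i) (p (i + 1)) (p j)}"
proof (induction m rule: inc_induct)
  case (step m)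
  let ?A = "\<lambda>m. {(i, j). m \<le> i \<and> i + 1 < j \<and> j \<le> n \<and> R (p i) (p (i + 1)) (p j)}"
  let ?B = "{j\<in>{Suc (Suc m)..<Suc n}. R (p m) (p (Suc m)) (p j)}"
  have "finite (?A (Suc m))"
    by (rule finite_subset[of _ "{..n} \<times> {..n}"]) auto
  moreover have "?A m = ?A (Suc m) \<union> Pair m ` ?B"
    by (auto simp: le_less Suc_le_eq)
  ultimately have "card (?A m) = card (?A (Suc m)) + card (Pair m ` ?B)"
    by (simp only:) (rule card_Un_disjoint, auto)
  also have "card (Pair m ` ?B) = card ?B"
    by (rule card_image) (simp add: inj_on_def)
  also have "?B = set (filter (\<lambda>j. R (p m) (p (Suc m)) (p j)) [Suc (Suc m)..<Suc n])"
    by auto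
  also have "card \<dots> = length (filter (R (p m) (p (Suc m))) (map p [Suc (Suc m)..<Suc n]))"
    by (subst distinct_card) (auto simp: filter_map o_def)
  finally have "card (?A m) = locc R (map p [Suc m..<Suc n])
      + length (filter (R (p m) (p (Suc m))) (map p [Suc (Suc m)..<Suc n]))"
    using step.IH by simp
  \<comment> \<open>For \<open>m = n\<close> no letter follows \<open>p m\<close>; the unspecified
    head is harmless because the tail is empty as well.\<close>
  moreover have "map p [Suc m..<Suc n] = [] \<or> hd (map p [Suc m..<Suc n]) = p (Suc m)"
    "tl (map p [Suc m..<Suc n]) = map p [Suc (Suc m)..<Suc n]"
    by (cases "m < n"; simp add: upt_conv_Cons[of "Suc m"] del: upt_Suc)+
  ultimately show ?case using step.hyps by (auto simp add: upt_conv_Cons[of m] simp del: upt_Suc)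
qed (auto intro!: card_eq_0_iff[THEN iffD2])

lemma lides_map_upt:
  "m \<le> Suc n \<Longrightarrow> lides (map p [m..<Suc n]) = card {i. m \<le> i \<and> i \<le> n \<and> (\<exists>j. i < j \<and> j \<le> n \<and> p i = Suc (p j))}"
proof (induction m rule: inc_induct)
  case (step m)
  let ?Q = "\<lambda>i. \<exists>j. i < j \<and> j \<le> n \<and> p i = Suc (p j)"
  let ?A = "\<lambda>m. {i. m \<le> i \<and> i \<le> n \<and> ?Q i}"
  have "?A m = (if ?Q m then insert m (?A (Suc m)) else ?A (Suc m))"
    using step.hyps by (auto simp: le_less Suc_le_eq)
  moreover have "lides (map p [m..<Suc n]) = lides (map p [Suc m..<Suc n]) + (if ?Q m then 1 else 0)"
    using step.hyps by (auto simp add: upt_conv_Cons Suc_le_eq less_Suc_eq_le simp del: upt_Suc)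
  ultimately show ?case using step.IH by (auto simp del: upt_Suc)
qed simp

lemma avoids_map_upt:
  "m \<le> Suc n \<Longrightarrow> avoids R (map p [m..<Suc n]) \<longleftrightarrow>
     \<not> (\<exists>i j k. m \<le> i \<and> i < j \<and> j < k \<and> k \<le> n \<and> R (p i) (p j) (p k))"
proof (induction m rule: inc_induct)
  case (step m)
  have "sorted_wrt (\<lambda>y z. \<not> R (p m) y z) (map p [Suc m..<Suc n]) \<longleftrightarrow>
      \<not> (\<exists>j k. m < j \<and> j < k \<and> k \<le> n \<and> R (p m) (p j) (p k))"
  proof -
    have "sorted_wrt P [a..<b] \<longleftrightarrow> (\<forall>j k. a \<le> j \<longrightarrow> j < k \<longrightarrow> k < b \<longrightarrow> P j k)" for P and a b :: nat
      by (induction b) (auto simp: sorted_wrt_append less_Suc_eq)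
    then show ?thesis by (simp add: sorted_wrt_map Suc_le_eq less_Suc_eq_le del: upt_Suc) blast
  qed
  then have "avoids R (map p [m..<Suc n]) \<longleftrightarrow> \<not> (\<exists>j k. m < j \<and> j < k \<and> k \<le> n \<and> R (p m) (p j) (p k))
      \<and> \<not> (\<exists>i j k. Suc m \<le> i \<and> i < j \<and> j < k \<and> k \<le> n \<and> R (p i) (p j) (p k))"
    using step by (simp add: upt_conv_Cons del: upt_Suc)
  also have "\<dots> \<longleftrightarrow> \<not> (\<exists>i j k. m \<le> i \<and> i < j \<and> j < k \<and> k \<le> n \<and> R (p i) (p j) (p k))"
  proof -
    have "m \<le> i \<longleftrightarrow> i = m \<or> Suc m \<le> i" for i by auto
    then show ?thesis by (simp only:) blast
  qed
  finally show ?case .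
qed simp

section \<open>Word statistics agree with permutation statistics\<close>

lemma ldes_word_of: "ldes (word_of n p) = des n p"
proof -
  have "descents n p = {i. 1 \<le> i \<and> i < n \<and> p (Suc i) < p i}" by (auto simp: descents_def)
  then show ?thesis using ldes_map_upt[of 1 n p] by (simp add: des_def del: upt_Suc)
qed

lemma lmaj_word_of: "lmaj (word_of n p) = maj n p"
  using lmaj_map_upt[of 1 n p] by (auto simp: maj_def descents_def simp del: upt_Suc intro!: sum.cong)

lemma lstat_word_of: "lstat (word_of n p) = stat n p"
  unfolding lstat_def ldes_word_of stat_def occ_13_2_def occ_21_3_def occ_32_1_def
  by (subst (1 2 3) locc_map_upt) simp_all

text \<open>A descent \<open>i\<close> of the inverse is sent to the position of the value
  \<open>i + 1\<close>; the value \<open>i\<close> then stands further right and is the witness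
  \<open>j\<close>.\<close>

lemma lides_word_of:
  assumes p: "p permutes {1..n}"
  shows "lides (word_of n p) = ides n p"
proof -
  let ?A = "{i. 1 \<le> i \<and> i \<le> n \<and> (\<exists>j. i < j \<and> j \<le> n \<and> p i = Suc (p j))}"
  let ?B = "{i \<in> {1..n - 1}. inv p i > inv p (i + 1)}"
  have inv: "inv p (p i) = i" "p (inv p i) = i" for i
    using permutes_inverses[OF p] by auto
  have mem: "1 \<le> p i \<and> p i \<le> n \<longleftrightarrow> 1 \<le> i \<and> i \<le> n" for i
    using permutes_in_image[OF p, of i] by simp
  have mem': "1 \<le> inv p i \<and> inv p i \<le> n \<longleftrightarrow> 1 \<le> i \<and> i \<le> n" for i
    using permutes_in_image[OF permutes_inv[OF p], of i] by simp
  have "bij_betw (\<lambda>i. inv p (i + 1)) ?B ?A"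
  proof (rule bij_betw_byWitness[where f' = "\<lambda>i. p i - 1"])
    show "\<forall>i\<in>?B. p (inv p (i + 1)) - 1 = i" by (simp add: inv)
    show "\<forall>i\<in>?A. inv p (p i - 1 + 1) = i" by (auto simp: inv) (metis inv(1))
    show "(\<lambda>i. inv p (i + 1)) ` ?B \<subseteq> ?A"
    proof (intro image_subsetI CollectI)
      fix i assume i: "i \<in> ?B"
      then have "1 \<le> inv p (i + 1) \<and> inv p (i + 1) \<le> n" "inv p i \<le> n" 
        using mem'[of i] mem'[of "i + 1"] by auto
      then show "1 \<le> inv p (i + 1) \<and> inv p (i + 1) \<le> n \<and>
          (\<exists>j>inv p (i + 1). j \<le> n \<and> p (inv p (i + 1)) = Suc (p j))"
        using i by (auto simp: inv intro!: exI[of _ "inv p i"])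
    qed
    \<comment> \<open>Here \<open>p i - 1\<close> is \<open>p j\<close>, a positive value, and its
      position \<open>j\<close> lies to the right of \<open>i\<close>.\<close>
    show "(\<lambda>i. p i - 1) ` ?A \<subseteq> ?B"
    proof (intro image_subsetI)
      fix i assume i: "i \<in> ?A"
      then obtain j where j: "i < j" "j \<le> n" "p i = Suc (p j)" by auto
      then show "p i - 1 \<in> ?B"
        using i mem[of i] mem[of j] inv(1)[of i] inv(1)[of j] by auto
    qed
  qed
  then have "card ?B = card ?A" by (rule bij_betw_same_card)
  then show ?thesis
    using lides_map_upt[of 1 n p] by (simp add: ides_def des_def descents_def del: upt_Suc)
qed

section \<open>Patterns of length three and one-line notation\<close>

lemma contains_pattern_3:
  "contains_pattern 3 \<sigma> n p \<longleftrightarrow> (\<exists>i j k. 1 \<le> i \<and> i < j \<and> j < k \<and> k \<le> n \<and>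
     (p i < p j \<longleftrightarrow> \<sigma> 1 < \<sigma> 2) \<and> (p j < p i \<longleftrightarrow> \<sigma> 2 < \<sigma> 1) \<and>
     (p i < p k \<longleftrightarrow> \<sigma> 1 < \<sigma> 3) \<and> (p k < p i \<longleftrightarrow> \<sigma> 3 < \<sigma> 1) \<and>
     (p j < p k \<longleftrightarrow> \<sigma> 2 < \<sigma> 3) \<and> (p k < p j \<longleftrightarrow> \<sigma> 3 < \<sigma> 2))"
  (is "_ \<longleftrightarrow> (\<exists>i j k. ?occ i j k)")
proof -
  have s: "{1..3} = {1, 2, 3 :: nat}" by auto
  show ?thesis
  proof
    assume "contains_pattern 3 \<sigma> n p"
    then obtain f where f: "f ` {1, 2, 3} \<subseteq> {1..n}" "strict_mono_on {1, 2, 3} f"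
      "\<forall>a\<in>{1, 2, 3}. \<forall>b\<in>{1, 2, 3}. p (f a) < p (f b) \<longleftrightarrow> \<sigma> a < \<sigma> b"
      unfolding contains_pattern_def s by blast
    have "1 \<le> f 1" "f 3 \<le> n" using f(1) by auto
    moreover have "f 1 < f 2" "f 2 < f 3"
      by (rule strict_mono_onD[OF f(2)]; simp)+
    ultimately have "?occ (f 1) (f 2) (f 3)"
      using f(3) by (intro conjI) blast+
    then show "\<exists>i j k. ?occ i j k" by blast
  next
    assume "\<exists>i j k. ?occ i j k"
    then obtain i j k where *: "?occ i j k" by blast
    define f where "f = (\<lambda>x :: nat. if x = 1 then i else if x = 2 then j else k)"
    have f: "f 1 = i" "f 2 = j" "f 3 = k" by (simp_all add: f_def)
    have "f ` {1, 2, 3} \<subseteq> {1..n}"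
      using * by (simp only: image_insert image_empty f) auto
    moreover have "strict_mono_on {1, 2, 3} f"
    proof (rule strict_mono_onI)
      fix a b :: nat assume "a \<in> {1, 2, 3}" "b \<in> {1, 2, 3}" "a < b"
      then consider "a = 1" "b = 2" | "a = 1" "b = 3" | "a = 2" "b = 3" by fastforce
      then show "f a < f b" using * by cases (simp_all only: f, simp_all)
    qed
    \<comment> \<open>Of the nine comparisons the three with \<open>a = b\<close> are trivial, and
      the other six are those listed in the statement.\<close>
    moreover have "\<forall>a\<in>{1, 2, 3}. \<forall>b\<in>{1, 2, 3}. p (f a) < p (f b) \<longleftrightarrow> \<sigma> a < \<sigma> b"
      using * by (simp only: ball_simps f less_irrefl simp_thms)
    ultimately show "contains_pattern 3 \<sigma> n p"
      unfolding contains_pattern_def s by blast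
  qed
qed

text \<open>The inverse is \<open>one_line\<close>, whose default value \<open>i\<close> outside the
  word is what \<open>permutes\<close> demands.\<close>

lemma bij_betw_word_of:
  "bij_betw (word_of n) {p. p permutes {1..n}} {xs. distinct xs \<and> set xs = {1..n}}"
proof (rule bij_betw_byWitness[where f' = one_line])
  show "\<forall>p\<in>{p. p permutes {1..n}}. one_line (word_of n p) = p"
    by (auto simp: one_line_def fun_eq_iff permutes_def simp del: upt_Suc)
  show "\<forall>xs\<in>{xs. distinct xs \<and> set xs = {1..n}}. word_of n (one_line xs) = xs"
  proof safe
    fix xs :: "nat list" assume "distinct xs" "set xs = {1..n}"
    then have "length xs = n" using distinct_card[of xs] by simp
    then show "word_of n (one_line xs) = xs"
      by (intro nth_equalityI) (auto simp: one_line_def simp del: upt_Suc)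
  qed
  show "word_of n ` {p. p permutes {1..n}} \<subseteq> {xs. distinct xs \<and> set xs = {1..n}}"
  proof (rule image_subsetI)
    fix p assume "p \<in> {p. p permutes {1..n}}"
    then show "word_of n p \<in> {xs. distinct xs \<and> set xs = {1..n}}"
      using permutes_image[of p "{1..n}"] permutes_inj_on[of p "{1..n}" "{1..n}"]
      by (simp add: distinct_map atLeastLessThanSuc_atLeastAtMost del: upt_Suc)
  qed
  show "one_line ` {xs. distinct xs \<and> set xs = {1..n}} \<subseteq> {p. p permutes {1..n}}"
  proof safe
    fix xs :: "nat list" assume *: "distinct xs" "set xs = {1..n}"
    then have l: "length xs = n" using distinct_card[of xs] by simp
    have "bij_betw (\<lambda>i. xs ! (i - 1)) {1..n} {1..n}"
    proof -
      have "bij_betw (\<lambda>i. i - 1) {1..n} {..<n}"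
        by (rule bij_betw_byWitness[where f' = Suc]) auto
      then have "bij_betw ((!) xs \<circ> (\<lambda>i. i - 1)) {1..n} (set xs)"
        by (rule bij_betw_trans) (simp add: bij_betw_nth * l)
      then show ?thesis by (simp add: o_def *)
    qed
    then have "bij_betw (one_line xs) {1..n} {1..n}"
      by (rule bij_betw_cong[THEN iffD1, rotated]) (simp add: one_line_def l)
    then show "one_line xs permutes {1..n}"
      by (rule bij_imp_permutes) (auto simp: one_line_def l)
  qed
qed

section \<open>Avoiders as words, and comparison of the counts\<close>

lemma bij_betw_restrict_iff:
  assumes "bij_betw f A B" "\<And>x. x \<in> A \<Longrightarrow> P x \<longleftrightarrow> Q (f x)"
  shows "bij_betw f {x \<in> A. P x} {y \<in> B. Q y}"
  using assms unfolding bij_betw_def by (auto simp: inj_on_def)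

text \<open>The chain of two inequalities in \<open>R213\<close> determines all six
  comparisons.\<close>

lemma contains_213:
  "contains_pattern 3 (one_line [2, 1, 3]) n p \<longleftrightarrow>
     (\<exists>i j k. 1 \<le> i \<and> i < j \<and> j < k \<and> k \<le> n \<and> R213 (p i) (p j) (p k))"
  by (subst contains_pattern_3, intro iff_exI) (auto simp: one_line_def)

lemma contains_231:
  "contains_pattern 3 (one_line [2, 3, 1]) n p \<longleftrightarrow>
     (\<exists>i j k. 1 \<le> i \<and> i < j \<and> j < k \<and> k \<le> n \<and> R231 (p i) (p j) (p k))"
  by (subst contains_pattern_3, intro iff_exI) (auto simp: one_line_def)

lemma bij_betw_avoiders_213: "bij_betw (word_of n) (avoiders n [2, 1, 3]) (words R213 n)"
proof -
  have "bij_betw (word_of n) {p \<in> {p. p permutes {1..n}}. \<not> contains_pattern 3 (one_line [2, 1, 3]) n p}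
      {xs \<in> {xs. distinct xs \<and> set xs = {1..n}}. avoids R213 xs}"
    by (intro bij_betw_restrict_iff bij_betw_word_of) (unfold contains_213, subst avoids_map_upt, simp_all)
  then show ?thesis by (simp add: avoiders_def words_def conj_assoc numeral_3_eq_3 del: upt_Suc)
qed

lemma bij_betw_avoiders_231: "bij_betw (word_of n) (avoiders n [2, 3, 1]) (words R231 n)"
proof -
  have "bij_betw (word_of n) {p \<in> {p. p permutes {1..n}}. \<not> contains_pattern 3 (one_line [2, 3, 1]) n p}
      {xs \<in> {xs. distinct xs \<and> set xs = {1..n}}. avoids R231 xs}"
    by (intro bij_betw_restrict_iff bij_betw_word_of) (unfold contains_231, subst avoids_map_upt, simp_all)
  then show ?thesis by (simp add: avoiders_def words_def conj_assoc numeral_3_eq_3 del: upt_Suc)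
qed

text \<open>As \<open>ides\<close> coincides with \<open>des\<close> on both classes, it is replaced
  by \<open>ldes\<close> and four statistics remain. An arbitrary \<open>P\<close> lets
  \<open>maj\<close> and \<open>stat\<close> exchange roles between the two applications.\<close>

lemma card_avoiders_eq_words:
  assumes bij: "bij_betw (word_of n) A (words R n)" and A: "\<And>p. p \<in> A \<Longrightarrow> p permutes {1..n}"
    and "n \<ge> 1" and ides: "\<And>xs. xs \<in> words R n \<Longrightarrow> lides xs = ldes xs"
  shows "card {p \<in> A. P (first_letter p) (maj n p) (stat n p) (des n p) (ides n p)} =
    card {xs \<in> words R n. P (hd xs) (lmaj xs) (lstat xs) (ldes xs) (ldes xs)}"
proof (rule bij_betw_same_card, rule bij_betw_restrict_iff[OF bij])
  fix p assume p: "p \<in> A"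
  then have "word_of n p \<in> words R n" using bij_betwE[OF bij] by blast
  then have "ides n p = ldes (word_of n p)" using ides lides_word_of[OF A[OF p]] by simp
  moreover have "hd (word_of n p) = first_letter p"
    using \<open>n \<ge> 1\<close> by (simp add: hd_map first_letter_def del: upt_Suc)
  ultimately show "P (first_letter p) (maj n p) (stat n p) (des n p) (ides n p) =
      P (hd (word_of n p)) (lmaj (word_of n p)) (lstat (word_of n p)) (ldes (word_of n p)) (ldes (word_of n p))"
    by (simp only: lmaj_word_of lstat_word_of ldes_word_of)
qed

text \<open>Both counts are pulled back to the same set of pairs of trees, so the bijection of the
  two classes stays implicit.\<close>

lemma card_words_213_231:
  "card {xs \<in> words R213 (Suc n). P (hd xs) (lmaj xs) (lstat xs) (ldes xs)} =
   card {xs \<in> words R231 (Suc n). P (hd xs) (lstat xs) (lmaj xs) (ldes xs)}"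
proof -
  let ?T = "{(u, v). size u + size v = n} :: (tree \<times> tree) set"
  let ?f = "\<lambda>(u, v). first213 (word213 u) (word213 v)"
  let ?g = "\<lambda>(u, v). first231 (word231 u) (word231 v)"
  have f: "bij_betw ?f ?T (words R213 (Suc n))"
    by (rule words_bij_betw_pairs[OF first213_words first213_inject first213_surj bij_betw_word213])
  have g: "bij_betw ?g ?T (words R231 (Suc n))"
    by (rule words_bij_betw_pairs[OF first231_words first231_inject first231_surj bij_betw_word231])
  \<comment> \<open>Both first letters are \<open>Suc (size u)\<close>. The other formulas depend on
    the parts only through sizes, \<open>ldes\<close> and the corrected sums that
    \<open>word213_word231_stats\<close> exchanges, once \<open>below_head\<close> is known to
    vanish for empty \<open>u\<close>.\<close>
  have "hd (?f x) = hd (?g x) \<and> lmaj (?f x) = lstat (?g x) \<and> lstat (?f x) = lmaj (?g x) \<and>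
      ldes (?f x) = ldes (?g x)" for x
  proof (cases x)
    case (Pair u v)
    note A = first213_stats[OF word213_words[of u] word213_words[of v]]
    note B = first231_stats[OF word231_words[of u] word231_words[of v]]
    have zero: "size u = 0 \<Longrightarrow> u = Leaf" by (cases u) auto
    have des: "ldes (word213 u) = ldes (word231 u)" "ldes (word213 v) = ldes (word231 v)"
      using word213_word231_stats by auto
    show ?thesis
      unfolding Pair prod.case A B des
      using word213_word231_stats[of u] word213_word231_stats[of v] zero
      by (cases "size u = 0"; simp only: des; simp; linarith)
  qed
  then have eq: "{x \<in> ?T. P (hd (?f x)) (lmaj (?f x)) (lstat (?f x)) (ldes (?f x))} =
      {x \<in> ?T. P (hd (?g x)) (lstat (?g x)) (lmaj (?g x)) (ldes (?g x))}"
    by (intro Collect_cong conj_cong refl) presburger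
  have "card {xs \<in> words R213 (Suc n). P (hd xs) (lmaj xs) (lstat xs) (ldes xs)} =
      card {x \<in> ?T. P (hd (?f x)) (lmaj (?f x)) (lstat (?f x)) (ldes (?f x))}"
    by (rule bij_betw_same_card[symmetric], rule bij_betw_restrict_iff[OF f refl])
  also note eq
  also have "card {x \<in> ?T. P (hd (?g x)) (lstat (?g x)) (lmaj (?g x)) (ldes (?g x))} =
      card {xs \<in> words R231 (Suc n). P (hd xs) (lstat xs) (lmaj xs) (ldes xs)}"
    by (rule bij_betw_same_card, rule bij_betw_restrict_iff[OF g refl])
  finally show ?thesis .
qed

theorem theorem2p1:
  fixes n :: nat and a b c d e :: int
  assumes "n \<ge> 1"
  shows "card {p \<in> avoiders n [2, 1, 3]. int (first_letter p) = a \<and> int (maj n p) = b \<and>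
                 int (stat n p) = c \<and> int (des n p) = d \<and> int (ides n p) = e} =
         card {p \<in> avoiders n [2, 3, 1]. int (first_letter p) = a \<and> int (stat n p) = b \<and>
                 int (maj n p) = c \<and> int (des n p) = d \<and> int (ides n p) = e}"
proof -
  have perm: "p permutes {1..n}" if "p \<in> avoiders n xs" for p xs
    using that by (simp add: avoiders_def)
  \<comment> \<open>The splitting at the first letter needs a nonempty word.\<close>
  obtain n' where n': "n = Suc n'" using assms by (cases n) auto
  have "card {p \<in> avoiders n [2, 1, 3]. int (first_letter p) = a \<and> int (maj n p) = b \<and>
                 int (stat n p) = c \<and> int (des n p) = d \<and> int (ides n p) = e} =
      card {xs \<in> words R213 n. int (hd xs) = a \<and> int (lmaj xs) = b \<and>
                 int (lstat xs) = c \<and> int (ldes xs) = d \<and> int (ldes xs) = e}"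
    by (rule card_avoiders_eq_words[OF bij_betw_avoiders_213 perm assms lides_eq_ldes_213,
        where P = "\<lambda>f m s d' e'. int f = a \<and> int m = b \<and> int s = c \<and> int d' = d \<and> int e' = e"])
  also have "\<dots> = card {xs \<in> words R231 n. int (hd xs) = a \<and> int (lstat xs) = b \<and>
                 int (lmaj xs) = c \<and> int (ldes xs) = d \<and> int (ldes xs) = e}"
    unfolding n'
    by (rule card_words_213_231[where P = "\<lambda>f m s d'. int f = a \<and> int m = b \<and> int s = c \<and> int d' = d \<and> int d' = e"])
  also have "\<dots> = card {p \<in> avoiders n [2, 3, 1]. int (first_letter p) = a \<and> int (stat n p) = b \<and>
                 int (maj n p) = c \<and> int (des n p) = d \<and> int (ides n p) = e}"
    by (rule card_avoiders_eq_words[OF bij_betw_avoiders_231 perm assms lides_eq_ldes_231,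
        where P = "\<lambda>f m s d' e'. int f = a \<and> int s = b \<and> int m = c \<and> int d' = d \<and> int e' = e", symmetric])
  finally show ?thesis .
qed

end
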